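(* Let $\mathcal{C}\subseteq\mathbb{F}_2^N$ be any linear block code, let $\underline{e}(1),\dots,\underline{e}(T)\in\mathbb{F}_2^N$ be an ordered list of distinct error patterns, and consider ORB-type GRAND with the rank-based permutation $\pi$ over an output-symmetric channel whose reliabilities $|\ell_i|$ have a continuous (atomless) distribution (transmitted codeword $\underline{W}$ uniform on $\mathcal{C}$, each $W_i$ uniform on $\mathbb{F}_2$). For $1\le i<t\le T$ put $\underline{e}(i,t)=\underline{e}(i)\oplus\underline{e}(t)$ and $\mathbf{g}_{it}^{(1)}=(N,w_{\mathrm H}(\underline{e}(i,t)))$. Then the event $A_{it}=\{\pi(\underline{e}(i,t))\in\mathcal{C}\}$ has probability $$\Pr(A_{it})=\frac{Z(\mathbf{g}_{it}^{(1)})}{\binom{N}{w_{\mathrm H}(\underline{e}(i,t))}}.$$ Consequently, the block error rate satisfies $$P_{\mathrm{err}}\le 1-\sum_{t=1}^{T}p_t+\sum_{t=1}^{T}p_t\sum_{i=1}^{t-1}\frac{Z(\mathbf{g}_{it}^{(1)})}{\binom{N}{w_{\mathrm H}(\underline{e}(i,t))}}.$$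
   Context: Channel: $q_0,q_1$ are probability densities on $\mathbb{R}$; when $\underline{w}\in\mathbb{F}_2^N$ is sent, the output $\underline{Y}\in\mathbb{R}^N$ has density $\prod_i q_{w_i}(y_i)$. The log-likelihood ratios are $\ell_i=\log(q_0(y_i)/q_1(y_i))$ and the hard decision is $\theta(\underline{y})\in\mathbb{F}_2^N$ with $\theta(\underline y)_i=\mathbf{1}(\ell_i<0)$. The channel is output-symmetric if $q_0(y)=q_1(-y)$ for all $y\in\mathbb{R}$. Rank-based permutation: let $r_i$ be the position of $|\ell_i|$ in the ascending ordering of $|\ell_1|,\dots,|\ell_N|$; then $\pi=\pi_{\underline{y}}$ acts on $\underline{e}\in\mathbb{F}_2^N$ by $\pi_{\underline{y}}(\underline{e})_i=e_{r_i}$. ORB-type GRAND decoding with ordered list $\underline{e}(1),\dots,\underline{e}(T)$: given $\underline{y}$, the decoder tests for $t=1,2,\dots,T$ whether $\theta(\underline{y})\oplus\pi_{\underline{y}}(\underline{e}(t))\in\mathcal{C}$; it stops at the first $t$ for which this holds and outputs that codeword; if no $t\le T$ works, it declares failure. $P_{\mathrm{err}}$ is the probability that the output is not the transmitted codeword. $p_t=\mathbf{E}_{\underline{Y}}[P_{\underline{W}|\underline{Y}}(\theta(\underline{Y})\oplus\pi_{\underline{Y}}(\underline{e}(t))\mid\underline{Y})]$. $w_{\mathrm H}$ is Hamming weight. $Z((N,w))$ is the number of codewords of $\mathcal{C}$ with Hamming weight $w$. A linear block code is a linear subspace of $\mathbb{F}_2^N$. *)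

theory Defs
  imports "HOL-Probability.Probability" "HOL-Library.Z2"
begin

(* F_2^N is bit ^ 'n and R^N is real ^ 'n with N = CARD('n); the finite index type is
   linearly ordered, so that its elements stand for the coordinates 1, ..., N in this order. *)

abbreviation linear_code :: "(bit ^ 'n) set \<Rightarrow> bool" where
  "linear_code C \<equiv> vec.subspace C"

definition hamming_weight :: "bit ^ 'n \<Rightarrow> nat" where
  "hamming_weight e = card {i. e $ i \<noteq> 0}"

definition weight_count :: "(bit ^ 'n) set \<Rightarrow> nat \<Rightarrow> nat" where
  "weight_count C w = card {c \<in> C. hamming_weight c = w}"

definition prob_density :: "(real \<Rightarrow> real) \<Rightarrow> bool" where
  "prob_density f \<longleftrightarrow>
     f \<in> borel_measurable borel \<and> (\<forall>y. 0 \<le> f y) \<and> (\<integral>\<^sup>+ y. ennreal (f y) \<partial>lborel) = 1"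

definition output_symmetric :: "(bit \<Rightarrow> real \<Rightarrow> real) \<Rightarrow> bool" where
  "output_symmetric q \<longleftrightarrow> (\<forall>y. q 0 y = q 1 (- y))"

definition channel_density :: "(bit \<Rightarrow> real \<Rightarrow> real) \<Rightarrow> bit ^ 'n \<Rightarrow> real ^ 'n \<Rightarrow> real" where
  "channel_density q w y = (\<Prod>i\<in>UNIV. q (w $ i) (y $ i))"

definition joint_density ::
    "(bit ^ 'n) set \<Rightarrow> (bit \<Rightarrow> real \<Rightarrow> real) \<Rightarrow> bit ^ 'n \<Rightarrow> real ^ 'n \<Rightarrow> real" where
  "joint_density C q w y = pmf (pmf_of_set C) w * channel_density q w y"

(* P(W = w | Y = y) by Bayes' formula. The denominator is the marginal density of Y,
   so the junk value 0 for a zero denominator only occurs on a null set of outputs. *)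
definition posterior ::
    "(bit ^ 'n) set \<Rightarrow> (bit \<Rightarrow> real \<Rightarrow> real) \<Rightarrow> bit ^ 'n \<Rightarrow> real ^ 'n \<Rightarrow> real" where
  "posterior C q w y = joint_density C q w y / (\<Sum>w'\<in>UNIV. joint_density C q w' y)"

(* log (q0 / q1), with log (a / 0) = \<infinity> and log 0 = -\<infinity>. The value 0 where both
   densities vanish is arbitrary: such outputs have probability zero. *)
definition llr :: "(bit \<Rightarrow> real \<Rightarrow> real) \<Rightarrow> real \<Rightarrow> ereal" where
  "llr q y =
     (if q 0 y = 0 \<and> q 1 y = 0 then 0
      else if q 1 y = 0 then \<infinity>
      else if q 0 y = 0 then - \<infinity>
      else ereal (ln (q 0 y / q 1 y)))"

definition hard_decision :: "(bit \<Rightarrow> real \<Rightarrow> real) \<Rightarrow> real ^ 'n \<Rightarrow> bit ^ 'n" where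
  "hard_decision q y = (\<chi> i. if llr q (y $ i) < 0 then 1 else 0)"

(* Position (from 1 to N) of coordinate i when the reliabilities are sorted in ascending
   order; ties are broken by the coordinate order. *)
definition reliability_rank ::
    "(bit \<Rightarrow> real \<Rightarrow> real) \<Rightarrow> real ^ ('n::{finite,linorder}) \<Rightarrow> 'n \<Rightarrow> nat" where
  "reliability_rank q y i =
     card {k. \<bar>llr q (y $ k)\<bar> < \<bar>llr q (y $ i)\<bar> \<or>
              \<bar>llr q (y $ k)\<bar> = \<bar>llr q (y $ i)\<bar> \<and> k \<le> i}"

(* The r-th element of the index type, for 1 \<le> r \<le> N. *)
definition coord :: "nat \<Rightarrow> 'n::{finite,linorder}" where
  "coord r = sorted_list_of_set UNIV ! (r - 1)"

definition rank_perm ::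
    "(bit \<Rightarrow> real \<Rightarrow> real) \<Rightarrow> real ^ ('n::{finite,linorder}) \<Rightarrow> bit ^ 'n::_ \<Rightarrow> bit ^ 'n::_" where
  "rank_perm q y e = (\<chi> i. e $ coord (reliability_rank q y i))"

definition candidate ::
    "(bit \<Rightarrow> real \<Rightarrow> real) \<Rightarrow> real ^ ('n::{finite,linorder}) \<Rightarrow> bit ^ 'n::_ \<Rightarrow> bit ^ 'n::_" where
  "candidate q y e = hard_decision q y + rank_perm q y e"

(* None is a declared decoding failure. *)
definition grand_decode ::
    "(bit ^ 'n::_) set \<Rightarrow> (bit \<Rightarrow> real \<Rightarrow> real) \<Rightarrow> (nat \<Rightarrow> bit ^ 'n::_) \<Rightarrow> nat \<Rightarrow>
     real ^ ('n::{finite,linorder}) \<Rightarrow> (bit ^ 'n::_) option" where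
  "grand_decode C q e T y =
     (if \<exists>t\<in>{1..T}. candidate q y (e t) \<in> C
      then Some (candidate q y (e (LEAST t. t \<in> {1..T} \<and> candidate q y (e t) \<in> C)))
      else None)"

end

theory Submission
  imports Defs
begin

text \<open>By output symmetry, negating the outputs at the positions where \<open>W\<close> is one reduces every event
  to the transmission of the zero word, in which the outputs are independent and identically
  distributed. Their law is invariant under coordinate permutations, and since the reliabilities are
  almost surely distinct, permuting the outputs permutes \<open>\<pi>(u)\<close> in the same way. Hence, on any
  permutation-invariant event, \<open>\<pi>(u)\<close> is uniform on the vectors of the weight of \<open>u\<close>. The event that
  the \<open>t\<close>-th candidate is the transmitted word is invariant up to a null set, so it is independent of
  \<open>A\<^sub>i\<^sub>t\<close>; its probability is \<open>p\<^sub>t\<close>. If that candidate is correct, linearity shows that the \<open>i\<close>-th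
  candidate is a codeword exactly when \<open>A\<^sub>i\<^sub>t\<close> occurs, and a union bound over \<open>i < t\<close> yields the claim.\<close>

instance bit :: finite
proof
  have "(UNIV :: bit set) = {0, 1}"
    by (intro UNIV_eq_I) (metis bit_not_one_iff insertCI)
  then show "finite (UNIV :: bit set)"
    by (metis finite.emptyI finite.insertI)
qed

lemma prod_Basis_cart:
  "(\<Prod>b\<in>(Basis :: (real ^ 'n) set). f b) = (\<Prod>i\<in>UNIV. f (axis i 1))"
proof -
  have "(Basis :: (real ^ 'n) set) = range (\<lambda>i. axis i 1)"
    by (auto simp: Basis_vec_def)
  moreover have "inj (\<lambda>i. axis i (1::real) :: real ^ 'n)"
    by (auto simp: inj_def axis_eq_axis)
  ultimately show ?thesis
    by (intro prod.reindex_cong) auto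
qed

lemma measurable_vec_lambda [measurable]:
  fixes f :: "'a \<Rightarrow> 'n::finite \<Rightarrow> real"
  assumes [measurable]: "\<And>i. (\<lambda>x. f x i) \<in> borel_measurable M"
  shows "(\<lambda>x. \<chi> i. f x i) \<in> borel_measurable M"
  unfolding borel_measurable_iff_halfspace_le[where 'c = "real ^ 'n"]
proof
  fix b :: "real ^ 'n" assume "b \<in> Basis"
  then obtain i where "b = axis i 1" by (auto simp: Basis_vec_def)
  then show "\<forall>a. {x \<in> space M. (\<chi> i. f x i) \<bullet> b \<le> a} \<in> sets M"
    by (simp add: inner_axis)
qed

lemma lborel_distr_signed_permutation:
  fixes s :: "'n::finite \<Rightarrow> real"
  assumes \<tau>: "bij \<tau>" and s: "\<And>i. s i = 1 \<or> s i = - 1"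
  shows "distr lborel borel (\<lambda>y :: real ^ 'n. \<chi> i. s i * y $ \<tau> i) = lborel" (is "distr _ _ ?g = _")
proof (rule lborel_eqI[symmetric])
  fix l u :: "real ^ 'n"
  assume "\<And>b. b \<in> Basis \<Longrightarrow> l \<bullet> b \<le> u \<bullet> b"
  then have le: "l $ i \<le> u $ i" for i
    by (metis axis_in_Basis_iff Basis_real_def cart_eq_inner_axis singletonI)
  define l' where "l' = (\<chi> j. let i = inv \<tau> j in if s i = 1 then l $ i else - u $ i)"
  define u' where "u' = (\<chi> j. let i = inv \<tau> j in if s i = 1 then u $ i else - l $ i)"
  have \<tau>': "\<tau> (inv \<tau> j) = j" "inv \<tau> (\<tau> j) = j" for j
    using \<tau> by (simp_all add: bij_is_surj surj_f_inv_f bij_is_inj)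
  have "y \<in> box l' u' \<longleftrightarrow> ?g y \<in> box l u" for y
  proof -
    have "y \<in> box l' u' \<longleftrightarrow> (\<forall>i. l' $ \<tau> i < y $ \<tau> i \<and> y $ \<tau> i < u' $ \<tau> i)"
      unfolding mem_box_cart by (metis \<tau>'(1))
    also have "\<dots> \<longleftrightarrow> (\<forall>i. l $ i < s i * y $ \<tau> i \<and> s i * y $ \<tau> i < u $ i)"
    proof (intro all_cong1)
      fix i show "(l' $ \<tau> i < y $ \<tau> i \<and> y $ \<tau> i < u' $ \<tau> i) =
         (l $ i < s i * y $ \<tau> i \<and> s i * y $ \<tau> i < u $ i)"
        using s[of i] by (auto simp: l'_def u'_def \<tau>')
    qed
    finally show ?thesis by (simp add: mem_box_cart)
  qed
  then have pre: "?g -` box l u \<inter> space lborel = box l' u'"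
    by auto
  have "emeasure (distr lborel borel ?g) (box l u) = emeasure lborel (box l' u')"
    by (subst emeasure_distr) (simp_all only: pre, simp_all)
  also have "\<dots> = (\<Prod>b\<in>Basis. (u' - l') \<bullet> b)"
  proof (rule emeasure_lborel_box)
    fix b :: "real ^ 'n" assume "b \<in> Basis"
    then show "l' \<bullet> b \<le> u' \<bullet> b"
      using le by (auto simp: Basis_vec_def inner_axis l'_def u'_def Let_def)
  qed
  also have "(\<Prod>b\<in>Basis. (u' - l') \<bullet> b) = (\<Prod>j\<in>UNIV. u' $ j - l' $ j)"
    by (simp add: prod_Basis_cart inner_axis)
  also have "\<dots> = (\<Prod>i\<in>UNIV. u' $ \<tau> i - l' $ \<tau> i)"
    by (rule prod.reindex_bij_betw[OF \<tau>, symmetric])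
  also have "\<dots> = (\<Prod>i\<in>UNIV. u $ i - l $ i)"
    by (intro prod.cong) (auto simp: l'_def u'_def \<tau>')
  also have "\<dots> = (\<Prod>b\<in>Basis. (u - l) \<bullet> b)"
    by (simp add: prod_Basis_cart inner_axis)
  finally show "emeasure (distr lborel borel ?g) (box l u) = (\<Prod>b\<in>Basis. (u - l) \<bullet> b)" .
qed simp

lemma borel_measurable_llr [measurable]:
  assumes "\<And>b. prob_density (q b)"
  shows "llr q \<in> borel_measurable borel"
proof -
  have [measurable]: "q b \<in> borel_measurable borel" for b
    using assms by (simp add: prob_density_def)
  show ?thesis unfolding llr_def by measurable
qed

lemma card_weight_eq:
  "card {v :: bit ^ 'n. hamming_weight v = w} = CARD('n) choose w"
proof -
  let ?f = "\<lambda>v :: bit ^ 'n. {i. v $ i \<noteq> 0}"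
  let ?g = "\<lambda>A. (\<chi> i. if i \<in> A then 1 else 0) :: bit ^ 'n"
  have fg: "?f (?g A) = A" for A
    by simp
  have gf: "?g (?f v) = v" for v
    by (auto simp: vec_eq_iff simp del: bit_not_zero_iff) simp
  have "bij_betw ?f {v. hamming_weight v = w} {A. A \<subseteq> UNIV \<and> card A = w}"
    unfolding hamming_weight_def
    by (rule bij_betw_byWitness[where f' = ?g]) (use fg gf in \<open>simp_all add: image_subset_iff\<close>)
  then have "card {v :: bit ^ 'n. hamming_weight v = w} = card {A. A \<subseteq> (UNIV :: 'n set) \<and> card A = w}"
    by (rule bij_betw_same_card)
  then show ?thesis
    by (simp only: n_subsets[OF finite])
qed

lemma bij_coord: "bij_betw (coord :: nat \<Rightarrow> 'n::{finite,linorder}) {1..CARD('n)} UNIV"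
proof -
  let ?l = "sorted_list_of_set (UNIV :: 'n set)"
  have "bij_betw ((!) ?l) {..<CARD('n)} UNIV"
    by (rule bij_betw_nth) auto
  moreover have "bij_betw (\<lambda>r. r - 1) {1..CARD('n)} {..<CARD('n)}"
    by (rule bij_betw_byWitness[where f' = Suc]) auto
  ultimately have "bij_betw ((!) ?l \<circ> (\<lambda>r. r - 1)) {1..CARD('n)} UNIV"
    by (rule bij_betw_trans[rotated])
  then show ?thesis
    by (simp add: coord_def[abs_def] comp_def)
qed

lemma hamming_weight_permute:
  assumes "bij \<tau>"
  shows "hamming_weight (\<chi> i. v $ \<tau> i) = hamming_weight v"
proof -
  have "bij_betw \<tau> {i. v $ \<tau> i \<noteq> 0} {i. v $ i \<noteq> 0}"
    using assms by (intro bij_betw_byWitness[where f' = "inv \<tau>"])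
      (auto simp: bij_is_inj bij_is_surj surj_f_inv_f)
  then show ?thesis
    unfolding hamming_weight_def by (simp add: bij_betw_same_card)
qed

lemma hamming_weight_eq_imp_permuted:
  fixes v v' :: "bit ^ 'n"
  assumes "hamming_weight v = hamming_weight v'"
  obtains \<tau> where "bij \<tau>" "v' = (\<chi> i. v $ \<tau> i)"
proof -
  let ?A = "{i. v $ i \<noteq> 0}" and ?A' = "{i. v' $ i \<noteq> 0}"
  have c: "card ?A' = card ?A" "card (- ?A') = card (- ?A)"
    using assms by (simp_all add: hamming_weight_def Compl_eq_Diff_UNIV card_Diff_subset)
  obtain f where f: "bij_betw f ?A' ?A"
    using c(1) by (metis finite finite_same_card_bij)
  obtain g where g: "bij_betw g (- ?A') (- ?A)"
    using c(2) by (metis finite finite_same_card_bij)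
  let ?\<tau> = "\<lambda>i. if i \<in> ?A' then f i else g i"
  have "bij_betw ?\<tau> (?A' \<union> - ?A') (?A \<union> - ?A)"
    by (rule bij_betw_disjoint_Un[OF f g]) auto
  then have "bij ?\<tau>" by (simp only: Compl_partition)
  moreover have "v' $ i = v $ ?\<tau> i" for i
  proof (cases "i \<in> ?A'")
    case True
    then have "f i \<in> ?A" using f bij_betwE by blast
    with True show ?thesis by simp
  next
    case False
    then have "g i \<in> - ?A" using g bij_betwE by blast
    with False show ?thesis by simp
  qed
  then have "v' = (\<chi> i. v $ ?\<tau> i)"
    by (simp add: vec_eq_iff)
  ultimately show ?thesis by (rule that)
qed

lemma bij_rank_coord:
  fixes y :: "real ^ 'n::{finite,linorder}"
  shows "bij (\<lambda>i. coord (reliability_rank q y i) :: 'n)"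
proof -
  let ?R = "\<lambda>i. \<bar>llr q (y $ i)\<bar>"
  let ?L = "\<lambda>i. {k. ?R k < ?R i \<or> ?R k = ?R i \<and> k \<le> i}"
  have rank: "reliability_rank q y i = card (?L i)" for i
    by (simp add: reliability_rank_def)
  have less: "reliability_rank q y i < reliability_rank q y j"
    if "?R i < ?R j \<or> ?R i = ?R j \<and> i < j" for i j
  proof -
    have "?L i \<subset> ?L j"
      using that by (auto intro: less_trans)
    then show ?thesis
      unfolding rank by (intro psubset_card_mono) auto
  qed
  have "reliability_rank q y i \<noteq> reliability_rank q y j" if "i \<noteq> j" for i j
    using less[of i j] less[of j i] that by (metis less_linear less_irrefl)
  then have inj: "inj (reliability_rank q y)"
    by (meson injI)
  have "reliability_rank q y i \<in> {1..CARD('n)}" for i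
  proof -
    have "i \<in> ?L i" by simp
    then have "card (?L i) \<noteq> 0" by (auto simp: card_eq_0_iff)
    moreover have "card (?L i) \<le> CARD('n)" by (intro card_mono) auto
    ultimately show ?thesis unfolding rank atLeastAtMost_iff by linarith
  qed
  then have "range (reliability_rank q y) \<subseteq> {1..CARD('n)}"
    by blast
  then have "inj (coord \<circ> reliability_rank q y :: 'n \<Rightarrow> 'n)"
    by (intro comp_inj_on inj inj_on_subset[OF bij_betw_imp_inj_on[OF bij_coord]])
  then show ?thesis
    by (simp add: comp_def finite_UNIV_inj_surj bij_def)
qed

lemma hamming_weight_rank_perm [simp]: "hamming_weight (rank_perm q y e) = hamming_weight e"
  unfolding rank_perm_def by (rule hamming_weight_permute[OF bij_rank_coord])

lemma reliability_rank_permute: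
  assumes "bij \<tau>" and inj: "inj (\<lambda>i. \<bar>llr q (y $ i)\<bar>)"
  shows "reliability_rank q (\<chi> i. y $ \<tau> i) i = reliability_rank q y (\<tau> i)"
proof -
  let ?R = "\<lambda>i. \<bar>llr q (y $ i)\<bar>"
  have R: "?R k = ?R j \<longleftrightarrow> k = j" for k j
    using inj by (meson injD)
  have T: "\<tau> k = \<tau> j \<longleftrightarrow> k = j" for k j
    using assms(1) by (metis bij_pointE)
  have "bij_betw \<tau> {k. ?R (\<tau> k) \<le> ?R (\<tau> i)} {k. ?R k \<le> ?R (\<tau> i)}"
    using assms(1) by (intro bij_betw_byWitness[where f' = "inv \<tau>"])
      (auto simp: bij_is_inj bij_is_surj surj_f_inv_f)
  moreover have "{k. ?R (\<tau> k) < ?R (\<tau> i) \<or> ?R (\<tau> k) = ?R (\<tau> i) \<and> k \<le> i} = {k. ?R (\<tau> k) \<le> ?R (\<tau> i)}"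
    by (auto simp: R T less_le)
  moreover have "{k. ?R k < ?R (\<tau> i) \<or> ?R k = ?R (\<tau> i) \<and> k \<le> \<tau> i} = {k. ?R k \<le> ?R (\<tau> i)}"
    by (auto simp: R less_le)
  ultimately show ?thesis
    by (simp add: reliability_rank_def bij_betw_same_card)
qed

lemma rank_perm_permute:
  assumes "bij \<tau>" and inj: "inj (\<lambda>i. \<bar>llr q (y $ i)\<bar>)"
  shows "rank_perm q (\<chi> i. y $ \<tau> i) e = (\<chi> i. rank_perm q y e $ \<tau> i)"
  by (simp add: rank_perm_def reliability_rank_permute[OF assms])

lemma rank_perm_add: "rank_perm q y (a + b) = rank_perm q y a + rank_perm q y b"
  by (simp add: rank_perm_def vec_eq_iff)

lemma measurable_Collect_finite:
  fixes P :: "'a \<Rightarrow> 'k::finite \<Rightarrow> bool"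
  assumes [measurable]: "\<And>k. Measurable.pred M (\<lambda>x. P x k)"
  shows "(\<lambda>x. {k. P x k}) \<in> M \<rightarrow>\<^sub>M count_space UNIV"
proof (subst measurable_count_space_eq2, simp, intro conjI ballI)
  fix K
  have "(\<lambda>x. {k. P x k}) -` {K} \<inter> space M = {x \<in> space M. \<forall>k. P x k \<longleftrightarrow> k \<in> K}"
    by auto
  also have "\<dots> \<in> sets M" by measurable
  finally show "(\<lambda>x. {k. P x k}) -` {K} \<inter> space M \<in> sets M" .
qed simp

lemma measurable_bit_vec:
  fixes f :: "'a \<Rightarrow> 'k::finite \<Rightarrow> bit"
  assumes [measurable]: "\<And>k. (\<lambda>x. f x k) \<in> M \<rightarrow>\<^sub>M count_space UNIV"
  shows "(\<lambda>x. \<chi> k. f x k) \<in> M \<rightarrow>\<^sub>M count_space UNIV"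
proof (subst measurable_count_space_eq2, simp, intro conjI ballI)
  fix v
  have "(\<lambda>x. \<chi> k. f x k) -` {v} \<inter> space M = {x \<in> space M. \<forall>k. f x k = v $ k}"
    by (auto simp: vec_eq_iff)
  also have "\<dots> \<in> sets M" by measurable
  finally show "(\<lambda>x. \<chi> k. f x k) -` {v} \<inter> space M \<in> sets M" .
qed simp

definition noise_law :: "(bit \<Rightarrow> real \<Rightarrow> real) \<Rightarrow> (real ^ 'n) measure" where
  "noise_law q = density lborel (\<lambda>y. ennreal (channel_density q 0 y))"

definition flip_signs :: "bit ^ 'n \<Rightarrow> real ^ 'n \<Rightarrow> real ^ 'n" where
  "flip_signs w y = (\<chi> i. (if w $ i = 0 then 1 else - 1) * y $ i)"

locale symmetric_channel =
  fixes q :: "bit \<Rightarrow> real \<Rightarrow> real"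
  assumes densities: "\<And>b. prob_density (q b)"
    and symmetric: "output_symmetric q"
begin

lemma q_measurable [measurable]: "q b \<in> borel_measurable borel"
  and q_nonneg [simp]: "0 \<le> q b x"
  and q_total: "(\<integral>\<^sup>+ x. ennreal (q b x) \<partial>lborel) = 1"
  using densities[of b] by (simp_all add: prob_density_def)

lemmas llr_measurable [measurable] = borel_measurable_llr[OF densities]

lemma q_uminus: "q 0 (- x) = q 1 x" "q 1 (- x) = q 0 x"
  using symmetric unfolding output_symmetric_def by (metis minus_minus)+

lemma llr_uminus: "llr q (- x) = - llr q x"
proof -
  have "ln (q 1 x / q 0 x) = - ln (q 0 x / q 1 x)" if "q 0 x \<noteq> 0" "q 1 x \<noteq> 0"
    using that q_nonneg[of 0 x] q_nonneg[of 1 x] by (simp add: ln_div)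
  then show ?thesis
    by (simp add: llr_def q_uminus)
qed

lemma rank_measurable [measurable]:
  "(\<lambda>y :: real ^ 'n::{finite,linorder}. reliability_rank q y i) \<in> borel \<rightarrow>\<^sub>M count_space UNIV"
proof -
  have "(\<lambda>y :: real ^ 'n::_. {k. \<bar>llr q (y $ k)\<bar> < \<bar>llr q (y $ i)\<bar> \<or>
              \<bar>llr q (y $ k)\<bar> = \<bar>llr q (y $ i)\<bar> \<and> k \<le> i}) \<in> borel \<rightarrow>\<^sub>M count_space UNIV"
    by (intro measurable_Collect_finite) measurable
  from measurable_compose[OF this measurable_count_space, of card] show ?thesis
    by (simp add: reliability_rank_def)
qed

lemma rank_perm_measurable [measurable]:
  "(\<lambda>y. rank_perm q y (e :: bit ^ 'n::{finite,linorder})) \<in> borel \<rightarrow>\<^sub>M count_space UNIV"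
  unfolding rank_perm_def by (intro measurable_bit_vec) measurable

lemma hard_decision_measurable [measurable]:
  "(hard_decision q :: real ^ 'n \<Rightarrow> _) \<in> borel \<rightarrow>\<^sub>M count_space UNIV"
  unfolding hard_decision_def by (intro measurable_bit_vec) measurable

lemma candidate_measurable [measurable]:
  "(\<lambda>y. candidate q y (e :: bit ^ 'n::{finite,linorder})) \<in> borel \<rightarrow>\<^sub>M count_space UNIV"
proof -
  have "(\<lambda>y. case (hard_decision q y, rank_perm q y e) of (a, b) \<Rightarrow> a + b) \<in> borel \<rightarrow>\<^sub>M count_space UNIV"
    by measurable
  then show ?thesis by (simp add: candidate_def)
qed

lemma channel_density_measurable [measurable]: "channel_density q w \<in> borel_measurable borel"
  unfolding channel_density_def by measurable

lemma channel_density_nonneg [simp]: "0 \<le> channel_density q w y"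
  unfolding channel_density_def by (intro prod_nonneg) simp

lemma sets_noise_law [simp, measurable_cong]: "sets (noise_law q) = sets borel"
  and space_noise_law [simp]: "space (noise_law q) = UNIV"
  by (simp_all add: noise_law_def)

lemma nn_integral_noise_prod:
  fixes h :: "'n::finite \<Rightarrow> real \<Rightarrow> ennreal"
  assumes [measurable]: "\<And>i. h i \<in> borel_measurable borel"
  shows "(\<integral>\<^sup>+ y. (\<Prod>i\<in>UNIV. h i (y $ i)) \<partial>noise_law q) =
    (\<Prod>i\<in>UNIV. \<integral>\<^sup>+ x. h i x \<partial>density lborel (\<lambda>x. ennreal (q 0 x)))"
proof -
  define idx where "idx = inv (\<lambda>i :: 'n. axis i (1 :: real))"
  have idx: "idx (axis i 1) = i" for i
    unfolding idx_def by (rule inv_f_f) (auto simp: inj_def axis_eq_axis)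
  define f where "f b x = ennreal (q 0 x) * h (idx b) x" for b x
  have [measurable]: "f b \<in> borel_measurable borel" for b
    unfolding f_def by measurable
  have "(\<integral>\<^sup>+ y. (\<Prod>i\<in>UNIV. h i (y $ i)) \<partial>noise_law q) =
      (\<integral>\<^sup>+ y. (\<Prod>b\<in>Basis. f b (y \<bullet> b)) \<partial>(lborel :: (real ^ 'n) measure))"
    unfolding noise_law_def
    by (subst nn_integral_density)
      (simp_all add: prod_Basis_cart f_def idx cart_eq_inner_axis[symmetric] prod.distrib
        channel_density_def prod_ennreal)
  also have "\<dots> = (\<Prod>b\<in>(Basis :: (real ^ 'n) set). \<integral>\<^sup>+ x. f b x \<partial>lborel)"
    by (rule nn_integral_lborel_prod) auto
  also have "\<dots> = (\<Prod>i\<in>UNIV. \<integral>\<^sup>+ x. h i x \<partial>density lborel (\<lambda>x. ennreal (q 0 x)))"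
    by (simp add: prod_Basis_cart f_def idx nn_integral_density)
  finally show ?thesis .
qed

lemma prob_space_bit_law: "prob_space (density lborel (\<lambda>x. ennreal (q 0 x)))"
  by (rule prob_spaceI) (simp add: emeasure_density q_total)

lemma prob_space_noise_law: "prob_space (noise_law q :: (real ^ 'n) measure)"
proof (rule prob_spaceI)
  interpret prob_space "density lborel (\<lambda>x. ennreal (q 0 x))" by (rule prob_space_bit_law)
  have "emeasure (noise_law q) (space (noise_law q :: (real ^ 'n) measure)) =
     (\<integral>\<^sup>+ y. (\<Prod>i\<in>UNIV. (\<lambda>_. 1) (y $ i)) \<partial>(noise_law q :: (real ^ 'n) measure))"
    by simp
  also have "\<dots> = 1"
    by (subst nn_integral_noise_prod) (use emeasure_space_1 in simp_all)
  finally show "emeasure (noise_law q) (space (noise_law q :: (real ^ 'n) measure)) = 1" .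
qed

lemma distr_noise_nth:
  "distr (noise_law q :: (real ^ 'n) measure) borel (\<lambda>y. y $ i) = density lborel (\<lambda>x. ennreal (q 0 x))"
proof (rule measure_eqI)
  interpret prob_space "density lborel (\<lambda>x. ennreal (q 0 x))" by (rule prob_space_bit_law)
  fix A assume "A \<in> sets (distr (noise_law q :: (real ^ 'n) measure) borel (\<lambda>y. y $ i))"
  then have [measurable]: "A \<in> sets borel" by simp
  define h :: "'n \<Rightarrow> real \<Rightarrow> ennreal" where "h k x = (if k = i then indicator A x else 1)" for k x
  have [measurable]: "h k \<in> borel_measurable borel" for k
    unfolding h_def by measurable
  have h: "(\<integral>\<^sup>+ x. h k x \<partial>density lborel (\<lambda>x. ennreal (q 0 x))) =
      (if k = i then emeasure (density lborel (\<lambda>x. ennreal (q 0 x))) A else 1)" for k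
    using emeasure_space_1 by (simp add: h_def)
  have "emeasure (distr (noise_law q :: (real ^ 'n) measure) borel (\<lambda>y. y $ i)) A =
      (\<integral>\<^sup>+ y. indicator A (y $ i) \<partial>(noise_law q :: (real ^ 'n) measure))"
    by (subst nn_integral_distr[symmetric, of _ _ borel]) simp_all
  also have "\<dots> = (\<integral>\<^sup>+ y. (\<Prod>k\<in>UNIV. h k (y $ k)) \<partial>(noise_law q :: (real ^ 'n) measure))"
    by (simp add: h_def)
  also have "\<dots> = emeasure (density lborel (\<lambda>x. ennreal (q 0 x))) A"
    by (subst nn_integral_noise_prod) (simp_all add: h)
  finally show "emeasure (distr (noise_law q :: (real ^ 'n) measure) borel (\<lambda>y. y $ i)) A =
    emeasure (density lborel (\<lambda>x. ennreal (q 0 x))) A" .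
qed simp

lemma distr_noise_nth_pair:
  assumes "i \<noteq> j"
  shows "distr (noise_law q :: (real ^ 'n) measure) (borel \<Otimes>\<^sub>M borel) (\<lambda>y. (y $ i, y $ j)) =
    density lborel (\<lambda>x. ennreal (q 0 x)) \<Otimes>\<^sub>M density lborel (\<lambda>x. ennreal (q 0 x))"
    (is "?D = ?\<nu> \<Otimes>\<^sub>M _")
proof (rule pair_measure_eqI[symmetric])
  interpret prob_space ?\<nu> by (rule prob_space_bit_law)
  show "sigma_finite_measure ?\<nu>" "sigma_finite_measure ?\<nu>" by unfold_locales
  show "sets (?\<nu> \<Otimes>\<^sub>M ?\<nu>) = sets ?D"
    by (auto intro!: sets_pair_measure_cong)
  fix A B assume "A \<in> sets ?\<nu>" "B \<in> sets ?\<nu>"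
  then have [measurable]: "A \<in> sets borel" "B \<in> sets borel" by simp_all
  define h :: "'n \<Rightarrow> real \<Rightarrow> ennreal" where
    "h k x = (if k = i then indicator A x else 1) * (if k = j then indicator B x else 1)" for k x
  have [measurable]: "h k \<in> borel_measurable borel" for k
    unfolding h_def by measurable
  have h: "(\<integral>\<^sup>+ x. h k x \<partial>?\<nu>) =
      (if k = i then emeasure ?\<nu> A else 1) * (if k = j then emeasure ?\<nu> B else 1)" for k
    using emeasure_space_1 assms by (simp add: h_def)
  have "emeasure ?D (A \<times> B) = (\<integral>\<^sup>+ y. indicator (A \<times> B) (y $ i, y $ j) \<partial>(noise_law q :: (real ^ 'n) measure))"
    by (subst nn_integral_distr[symmetric, of _ _ "borel \<Otimes>\<^sub>M borel"]) simp_all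
  also have "\<dots> = (\<integral>\<^sup>+ y. (\<Prod>k\<in>UNIV. h k (y $ k)) \<partial>(noise_law q :: (real ^ 'n) measure))"
    by (simp add: h_def prod.distrib indicator_times)
  also have "\<dots> = emeasure ?\<nu> A * emeasure ?\<nu> B"
    by (subst nn_integral_noise_prod) (simp_all add: h prod.distrib)
  finally show "emeasure ?\<nu> A * emeasure ?\<nu> B = emeasure ?D (A \<times> B)" ..
qed

lemma nn_integral_channel_density:
  fixes g :: "real ^ 'n \<Rightarrow> ennreal"
  assumes [measurable]: "g \<in> borel_measurable borel"
  shows "(\<integral>\<^sup>+ y. ennreal (channel_density q w y) * g y \<partial>lborel) =
    (\<integral>\<^sup>+ y. g (flip_signs w y) \<partial>noise_law q)"
proof -
  have flip_signs: "distr lborel borel (flip_signs w) = lborel"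
    unfolding flip_signs_def[abs_def] by (rule lborel_distr_signed_permutation[where \<tau> = id, simplified]) simp
  have [measurable]: "flip_signs w \<in> borel_measurable borel"
    unfolding flip_signs_def[abs_def] by measurable
  have "q (w $ i) (flip_signs w y $ i) = q 0 (y $ i)" for i y
    by (cases "w $ i = 0") (simp_all add: flip_signs_def q_uminus)
  then have ch: "channel_density q w (flip_signs w y) = channel_density q 0 y" for y
    by (simp add: channel_density_def)
  have "(\<integral>\<^sup>+ y. ennreal (channel_density q w y) * g y \<partial>lborel) =
    (\<integral>\<^sup>+ y. ennreal (channel_density q w y) * g y \<partial>distr lborel borel (flip_signs w))"
    by (simp only: flip_signs)
  also have "\<dots> = (\<integral>\<^sup>+ y. ennreal (channel_density q 0 y) * g (flip_signs w y) \<partial>lborel)"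
    by (subst nn_integral_distr) (simp_all add: ch)
  also have "\<dots> = (\<integral>\<^sup>+ y. g (flip_signs w y) \<partial>noise_law q)"
    unfolding noise_law_def by (subst nn_integral_density) simp_all
  finally show ?thesis .
qed

lemma distr_noise_permute:
  fixes \<tau> :: "'n::finite \<Rightarrow> 'n"
  assumes \<tau>: "bij \<tau>"
  shows "distr (noise_law q) borel (\<lambda>y :: real ^ 'n. \<chi> i. y $ \<tau> i) = noise_law q" (is "distr _ _ ?g = _")
proof (rule measure_eqI)
  have perm: "distr lborel borel ?g = lborel"
    using lborel_distr_signed_permutation[OF \<tau>, of "\<lambda>_. 1"] by simp
  have ch: "channel_density q 0 (?g y) = channel_density q 0 y" for y
    unfolding channel_density_def using prod.reindex_bij_betw[OF \<tau>, of "\<lambda>i. q 0 (y $ i)"] by simp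
  fix A assume "A \<in> sets (distr (noise_law q) borel ?g)"
  then have [measurable]: "A \<in> sets borel" by simp
  have "emeasure (distr (noise_law q) borel ?g) A = (\<integral>\<^sup>+ y. indicator A (?g y) \<partial>noise_law q)"
    by (subst nn_integral_distr[symmetric, of _ _ borel]) simp_all
  also have "\<dots> = (\<integral>\<^sup>+ y. ennreal (channel_density q 0 (?g y)) * indicator A (?g y) \<partial>lborel)"
    unfolding noise_law_def ch by (subst nn_integral_density) simp_all
  also have "\<dots> = (\<integral>\<^sup>+ y. ennreal (channel_density q 0 y) * indicator A y \<partial>distr lborel borel ?g)"
    by (subst nn_integral_distr) simp_all
  also have "\<dots> = emeasure (noise_law q) A"
    unfolding perm noise_law_def by (subst emeasure_density) simp_all
  finally show "emeasure (distr (noise_law q) borel ?g) A = emeasure (noise_law q) A" .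
qed simp

lemma reliability_flip [simp]: "\<bar>llr q (flip_signs w y $ i)\<bar> = \<bar>llr q (y $ i)\<bar>"
  by (simp add: flip_signs_def llr_uminus)

lemma rank_perm_flip [simp]: "rank_perm q (flip_signs w y) e = rank_perm q y e"
  unfolding rank_perm_def reliability_rank_def by simp

lemma hard_decision_flip:
  assumes "\<And>i. llr q (y $ i) \<noteq> 0"
  shows "hard_decision q (flip_signs w y) = w + hard_decision q y"
proof -
  have "hard_decision q (flip_signs w y) $ i = w $ i + hard_decision q y $ i" for i
    using assms[of i]
    by (cases "w $ i = 0") (auto simp: hard_decision_def flip_signs_def llr_uminus ereal_uminus_less_reorder)
  then show ?thesis by (simp add: vec_eq_iff)
qed

end

locale atomless_channel = symmetric_channel +
  assumes atomless: "\<And>c. emeasure (density lborel (\<lambda>x. ennreal (q 0 x))) {x. \<bar>llr q x\<bar> = c} = 0"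
begin

lemma AE_reliability_neq: "AE x in density lborel (\<lambda>x. ennreal (q 0 x)). \<bar>llr q x\<bar> \<noteq> c"
  using atomless[of c] by (subst AE_iff_measurable[OF _ refl]) simp_all

lemma AE_llr_nonzero: "AE y in (noise_law q :: (real ^ 'n) measure). \<forall>i. llr q (y $ i) \<noteq> 0"
proof -
  have "AE y in (noise_law q :: (real ^ 'n) measure). llr q (y $ i) \<noteq> 0" for i
  proof -
    have "AE x in distr (noise_law q :: (real ^ 'n) measure) borel (\<lambda>y. y $ i). \<bar>llr q x\<bar> \<noteq> 0"
      unfolding distr_noise_nth by (rule AE_reliability_neq)
    then show ?thesis
      by (subst (asm) AE_distr_iff) auto
  qed
  then show ?thesis
    by (simp add: AE_all_countable)
qed

lemma AE_reliability_inj: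
  "AE y in (noise_law q :: (real ^ 'n) measure). inj (\<lambda>i. \<bar>llr q (y $ i)\<bar>)"
proof -
  let ?\<nu> = "density lborel (\<lambda>x. ennreal (q 0 x))"
  interpret \<nu>: prob_space ?\<nu> by (rule prob_space_bit_law)
  interpret pair_sigma_finite ?\<nu> ?\<nu> ..
  have "AE y in (noise_law q :: (real ^ 'n) measure). i \<noteq> j \<longrightarrow> \<bar>llr q (y $ i)\<bar> \<noteq> \<bar>llr q (y $ j)\<bar>" for i j
  proof (cases "i = j")
    case False
    have "AE z in ?\<nu> \<Otimes>\<^sub>M ?\<nu>. \<bar>llr q (fst z)\<bar> \<noteq> \<bar>llr q (snd z)\<bar>"
    proof (rule AE_pair_measure)
      show "AE x in ?\<nu>. AE x' in ?\<nu>. \<bar>llr q (fst (x, x'))\<bar> \<noteq> \<bar>llr q (snd (x, x'))\<bar>"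
      proof (rule AE_I2)
        fix x
        show "AE x' in ?\<nu>. \<bar>llr q (fst (x, x'))\<bar> \<noteq> \<bar>llr q (snd (x, x'))\<bar>"
          using AE_reliability_neq[of "\<bar>llr q x\<bar>"] by eventually_elim simp
      qed
    qed measurable
    then show ?thesis
      unfolding distr_noise_nth_pair[OF False, symmetric]
      by (subst (asm) AE_distr_iff) (auto simp: False)
  qed simp
  then have "AE y in (noise_law q :: (real ^ 'n) measure).
      \<forall>i j. i \<noteq> j \<longrightarrow> \<bar>llr q (y $ i)\<bar> \<noteq> \<bar>llr q (y $ j)\<bar>"
    by (simp add: AE_all_countable)
  then show ?thesis
    by eventually_elim (auto simp: inj_def)
qed

lemma noise_rank_perm_eq:
  fixes B :: "real ^ 'n::{finite,linorder} \<Rightarrow> bool"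
  assumes B [measurable]: "Measurable.pred borel B"
    and inv: "\<And>\<tau> y. bij \<tau> \<Longrightarrow> inj (\<lambda>i. \<bar>llr q (y $ i)\<bar>) \<Longrightarrow> B (\<chi> i. y $ \<tau> i) \<longleftrightarrow> B y"
    and w: "hamming_weight v = hamming_weight v'"
  shows "measure (noise_law q) {y. B y \<and> rank_perm q y u = v'} =
    measure (noise_law q) {y. B y \<and> rank_perm q y u = v}"
proof -
  obtain \<tau> where \<tau>: "bij \<tau>" and v': "v' = (\<chi> i. v $ \<tau> i)"
    using hamming_weight_eq_imp_permuted[OF w] by blast
  interpret prob_space "noise_law q :: (real ^ 'n::_) measure" by (rule prob_space_noise_law)
  let ?g = "\<lambda>y :: real ^ 'n::_. \<chi> i. y $ \<tau> i"
  have eq: "(\<lambda>i. a $ \<tau> i) = (\<lambda>i. v $ \<tau> i) \<longleftrightarrow> a = v" for a :: "bit ^ 'n::_"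
    using \<tau> by (simp add: vec_eq_iff fun_eq_iff) (metis bij_pointE)
  have "measure (noise_law q) {y. B y \<and> rank_perm q y u = v'} =
      measure (distr (noise_law q) borel ?g) {y. B y \<and> rank_perm q y u = v'}"
    by (simp only: distr_noise_permute[OF \<tau>])
  also have "\<dots> = measure (noise_law q) {y. B (?g y) \<and> rank_perm q (?g y) u = v'}"
    by (subst measure_distr) (simp_all add: vimage_def)
  also have "\<dots> = measure (noise_law q) {y. B y \<and> rank_perm q y u = v}"
  proof (rule finite_measure_eq_AE)
    show "AE y in noise_law q. y \<in> {y. B (?g y) \<and> rank_perm q (?g y) u = v'} \<longleftrightarrow>
        y \<in> {y. B y \<and> rank_perm q y u = v}"
      using AE_reliability_inj
    proof eventually_elim
      fix y :: "real ^ 'n::_"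
      assume y: "inj (\<lambda>i. \<bar>llr q (y $ i)\<bar>)"
      show "y \<in> {y. B (?g y) \<and> rank_perm q (?g y) u = v'} \<longleftrightarrow>
          y \<in> {y. B y \<and> rank_perm q y u = v}"
        by (simp add: inv[OF \<tau> y] rank_perm_permute[OF \<tau> y] v' eq)
    qed
  qed measurable
  finally show ?thesis .
qed

lemma noise_rank_perm_in_code:
  fixes B :: "real ^ 'n::{finite,linorder} \<Rightarrow> bool"
  assumes B [measurable]: "Measurable.pred borel B"
    and inv: "\<And>\<tau> y. bij \<tau> \<Longrightarrow> inj (\<lambda>i. \<bar>llr q (y $ i)\<bar>) \<Longrightarrow> B (\<chi> i. y $ \<tau> i) \<longleftrightarrow> B y"
  shows "measure (noise_law q) {y. B y \<and> rank_perm q y u \<in> C} =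
    measure (noise_law q) {y. B y} *
      (real (weight_count C (hamming_weight u)) / real (CARD('n) choose hamming_weight u))"
proof -
  interpret prob_space "noise_law q :: (real ^ 'n::_) measure" by (rule prob_space_noise_law)
  let ?E = "\<lambda>v. {y. B y \<and> rank_perm q y u = v}"
  define r where "r = measure (noise_law q) (?E u)"
  have r: "measure (noise_law q) (?E v) = r" if "hamming_weight v = hamming_weight u" for v
    unfolding r_def by (rule noise_rank_perm_eq[OF B inv]) (use that in simp_all)
  have count: "measure (noise_law q) {y. B y \<and> rank_perm q y u \<in> D} =
      real (weight_count D (hamming_weight u)) * r" for D
  proof -
    let ?D = "{c \<in> D. hamming_weight c = hamming_weight u}"
    have "{y. B y \<and> rank_perm q y u \<in> D} = (\<Union>v\<in>?D. ?E v)"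
      by auto
    also have "measure (noise_law q) \<dots> = (\<Sum>v\<in>?D. measure (noise_law q) (?E v))"
      by (rule finite_measure_finite_Union) (auto simp: disjoint_family_on_def)
    also have "\<dots> = real (weight_count D (hamming_weight u)) * r"
      by (simp add: r weight_count_def)
    finally show ?thesis .
  qed
  have "hamming_weight u \<le> CARD('n)"
    unfolding hamming_weight_def by (intro card_mono) auto
  then show ?thesis
    using count[of C] count[of UNIV] by (simp add: weight_count_def card_weight_eq)
qed

end

locale code_transmission = prob_space M + symmetric_channel q
  for M :: "'a measure" and q +
  fixes C :: "(bit ^ 'n::{finite,linorder}) set"
    and W :: "'a \<Rightarrow> bit ^ 'n::_"
    and Y :: "'a \<Rightarrow> real ^ 'n::_"
  assumes code_nonempty: "C \<noteq> {}"
    and joint: "distributed M (count_space UNIV \<Otimes>\<^sub>M lborel) (\<lambda>\<omega>. (W \<omega>, Y \<omega>))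
                  (\<lambda>(w, y). ennreal (joint_density C q w y))"
begin

lemma W_measurable [measurable]: "W \<in> M \<rightarrow>\<^sub>M count_space UNIV"
  and Y_measurable [measurable]: "Y \<in> M \<rightarrow>\<^sub>M borel"
proof -
  have WY: "(\<lambda>\<omega>. (W \<omega>, Y \<omega>)) \<in> M \<rightarrow>\<^sub>M count_space UNIV \<Otimes>\<^sub>M lborel"
    using joint by (rule distributed_measurable)
  show "W \<in> M \<rightarrow>\<^sub>M count_space UNIV"
    using measurable_compose[OF WY measurable_fst] by simp
  show "Y \<in> M \<rightarrow>\<^sub>M borel"
    using measurable_compose[OF WY measurable_snd] by simp
qed

lemma joint_density_measurable [measurable]: "joint_density C q w \<in> borel_measurable borel"
  unfolding joint_density_def by measurable

lemma joint_density_nonneg [simp]: "0 \<le> joint_density C q w y"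
  by (simp add: joint_density_def)

lemma nn_integral_joint:
  assumes [measurable]: "\<And>w. g w \<in> borel_measurable borel"
  shows "(\<integral>\<^sup>+ \<omega>. g (W \<omega>) (Y \<omega>) \<partial>M) =
    (\<Sum>w\<in>UNIV. \<integral>\<^sup>+ y. ennreal (joint_density C q w y) * g w y \<partial>lborel)"
proof -
  let ?N = "count_space UNIV \<Otimes>\<^sub>M lborel :: ((bit ^ 'n::_) \<times> (real ^ 'n::_)) measure"
  have g: "case_prod g \<in> borel_measurable ?N"
    by (rule measurable_pair_measure_countable1) (simp_all add: countable_finite)
  have f: "(\<lambda>x. (case x of (w, y) \<Rightarrow> ennreal (joint_density C q w y)) * case_prod g x) \<in> borel_measurable ?N"
    by (rule measurable_pair_measure_countable1) (simp_all add: countable_finite)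
  have "(\<integral>\<^sup>+ \<omega>. g (W \<omega>) (Y \<omega>) \<partial>M) =
      (\<integral>\<^sup>+ x. (case x of (w, y) \<Rightarrow> ennreal (joint_density C q w y)) * case_prod g x \<partial>?N)"
    using distributed_nn_integral[OF joint g] by simp
  also have "\<dots> = (\<integral>\<^sup>+ w. \<integral>\<^sup>+ y. ennreal (joint_density C q w y) * g w y \<partial>lborel \<partial>count_space UNIV)"
    by (subst lborel.nn_integral_fst[OF f, symmetric]) simp
  also have "\<dots> = (\<Sum>w\<in>UNIV. \<integral>\<^sup>+ y. ennreal (joint_density C q w y) * g w y \<partial>lborel)"
    by (rule nn_integral_count_space_finite) simp
  finally show ?thesis .
qed

lemma AE_W_in_code: "AE \<omega> in M. W \<omega> \<in> C"
proof (subst AE_iff_nn_integral)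
  have "joint_density C q w y = 0" if "w \<notin> C" for w y
    using code_nonempty that by (simp add: joint_density_def)
  then have "ennreal (joint_density C q w y) * indicator (- C) w = 0" for w y
    by (simp split: split_indicator)
  then show "(\<integral>\<^sup>+ \<omega>. indicator {\<omega>. \<not> W \<omega> \<in> C} \<omega> \<partial>M) = 0"
    using nn_integral_joint[of "\<lambda>w y. indicator (- C) w"]
    by (simp only: borel_measurable_const) (simp add: indicator_def)
qed measurable

lemma prob_eq_noise:
  assumes [measurable]: "\<And>w. Measurable.pred borel (Q w)" "Measurable.pred borel Q'"
    and Q': "\<And>w. AE y in noise_law q. Q w (flip_signs w y) \<longleftrightarrow> Q' y"
  shows "prob {\<omega> \<in> space M. Q (W \<omega>) (Y \<omega>)} = measure (noise_law q) {y. Q' y}"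
proof -
  have QWY [measurable]: "Measurable.pred M (\<lambda>\<omega>. Q (W \<omega>) (Y \<omega>))"
  proof -
    have "case_prod Q \<in> count_space UNIV \<Otimes>\<^sub>M borel \<rightarrow>\<^sub>M count_space UNIV"
      by (rule measurable_pair_measure_countable1) (simp_all add: countable_finite)
    from measurable_compose[OF _ this, of "\<lambda>\<omega>. (W \<omega>, Y \<omega>)" M] show ?thesis by simp
  qed
  have *: "(\<integral>\<^sup>+ y. ennreal (joint_density C q w y) * indicator {y. Q w y} y \<partial>lborel) =
      ennreal (pmf (pmf_of_set C) w) * emeasure (noise_law q) {y. Q' y}" for w
  proof -
    have "(\<integral>\<^sup>+ y. ennreal (joint_density C q w y) * indicator {y. Q w y} y \<partial>lborel) =
        (\<integral>\<^sup>+ y. ennreal (pmf (pmf_of_set C) w) *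
          (ennreal (channel_density q w y) * indicator {y. Q w y} y) \<partial>lborel)"
      by (simp add: joint_density_def ennreal_mult mult.assoc)
    also have "\<dots> = ennreal (pmf (pmf_of_set C) w) *
        (\<integral>\<^sup>+ y. ennreal (channel_density q w y) * indicator {y. Q w y} y \<partial>lborel)"
      by (rule nn_integral_cmult) measurable
    also have "(\<integral>\<^sup>+ y. ennreal (channel_density q w y) * indicator {y. Q w y} y \<partial>lborel) =
        (\<integral>\<^sup>+ y. indicator {y. Q w y} (flip_signs w y) \<partial>noise_law q)"
      by (rule nn_integral_channel_density) measurable
    also have "\<dots> = (\<integral>\<^sup>+ y. indicator {y. Q' y} y \<partial>noise_law q)"
      by (rule nn_integral_cong_AE) (use Q'[of w] in \<open>eventually_elim, simp split: split_indicator\<close>)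
    also have "\<dots> = emeasure (noise_law q) {y. Q' y}"
      by simp
    finally show ?thesis .
  qed
  have "emeasure M {\<omega> \<in> space M. Q (W \<omega>) (Y \<omega>)} =
      (\<integral>\<^sup>+ \<omega>. indicator {\<omega> \<in> space M. Q (W \<omega>) (Y \<omega>)} \<omega> \<partial>M)"
    by simp
  also have "\<dots> = (\<integral>\<^sup>+ \<omega>. indicator {y. Q (W \<omega>) y} (Y \<omega>) \<partial>M)"
    by (rule nn_integral_cong) (simp split: split_indicator)
  also have "\<dots> = (\<Sum>w\<in>UNIV. ennreal (pmf (pmf_of_set C) w) * emeasure (noise_law q) {y. Q' y})"
    by (subst nn_integral_joint) (simp_all add: *)
  also have "\<dots> = emeasure (noise_law q) {y. Q' y}"
    by (simp add: sum_distrib_right[symmetric] sum_ennreal sum_pmf_eq_1)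
  finally show ?thesis
    by (simp add: measure_def)
qed

lemma prob_reliability_eq:
  "prob {\<omega> \<in> space M. \<bar>llr q (Y \<omega> $ i)\<bar> = c} =
    measure (density lborel (\<lambda>x. ennreal (q 0 x))) {x. \<bar>llr q x\<bar> = c}"
proof -
  have "prob {\<omega> \<in> space M. \<bar>llr q (Y \<omega> $ i)\<bar> = c} =
      measure (noise_law q) {y :: real ^ 'n::_. \<bar>llr q (y $ i)\<bar> = c}"
    by (rule prob_eq_noise[where Q = "\<lambda>_ y. \<bar>llr q (y $ i)\<bar> = c"]) simp_all
  also have "\<dots> = measure (distr (noise_law q :: (real ^ 'n::_) measure) borel (\<lambda>y. y $ i)) {x. \<bar>llr q x\<bar> = c}"
    by (subst measure_distr) (simp_all add: vimage_def)
  finally show ?thesis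
    by (simp only: distr_noise_nth)
qed

lemma expectation_posterior:
  assumes [measurable]: "f \<in> borel \<rightarrow>\<^sub>M count_space UNIV"
  shows "expectation (\<lambda>\<omega>. posterior C q (f (Y \<omega>)) (Y \<omega>)) = prob {\<omega> \<in> space M. W \<omega> = f (Y \<omega>)}"
proof -
  let ?s = "\<lambda>y. \<Sum>w\<in>UNIV. joint_density C q w y"
  have s_nonneg: "0 \<le> ?s y" for y
    by (intro sum_nonneg) simp
  have nonneg: "0 \<le> posterior C q w y" for w y
    by (simp add: posterior_def s_nonneg)
  have post [measurable]: "posterior C q w \<in> borel_measurable borel" for w
    unfolding posterior_def by measurable
  have post_f [measurable]: "(\<lambda>y. posterior C q (f y) y) \<in> borel_measurable borel"
    by (rule measurable_compose_countable[OF post]) (simp_all add: assms)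
  have bayes: "?s y * posterior C q w y = joint_density C q w y" for w y
  proof (cases "?s y = 0")
    case True
    then have "joint_density C q w y = 0"
      by (subst (asm) sum_nonneg_eq_0_iff) simp_all
    with True show ?thesis by simp
  qed (simp add: posterior_def)
  have "(\<integral>\<^sup>+ \<omega>. ennreal (posterior C q (f (Y \<omega>)) (Y \<omega>)) \<partial>M) =
      (\<Sum>w\<in>UNIV. \<integral>\<^sup>+ y. ennreal (joint_density C q w y) * ennreal (posterior C q (f y) y) \<partial>lborel)"
    by (rule nn_integral_joint) measurable
  also have "\<dots> = (\<integral>\<^sup>+ y. (\<Sum>w\<in>UNIV. ennreal (joint_density C q w y) * ennreal (posterior C q (f y) y)) \<partial>lborel)"
    by (rule nn_integral_sum[symmetric]) measurable
  also have "\<dots> = (\<integral>\<^sup>+ y. ennreal (joint_density C q (f y) y) \<partial>lborel)"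
    by (simp add: sum_distrib_right[symmetric] sum_ennreal ennreal_mult[symmetric] s_nonneg nonneg bayes)
  also have "\<dots> = (\<integral>\<^sup>+ y. (\<Sum>w\<in>UNIV. ennreal (joint_density C q w y) * indicator {y. w = f y} y) \<partial>lborel)"
    by (simp add: indicator_def if_distrib cong: if_cong)
  also have "\<dots> = (\<Sum>w\<in>UNIV. \<integral>\<^sup>+ y. ennreal (joint_density C q w y) * indicator {y. w = f y} y \<partial>lborel)"
    by (rule nn_integral_sum) measurable
  also have "\<dots> = (\<integral>\<^sup>+ \<omega>. indicator {y. W \<omega> = f y} (Y \<omega>) \<partial>M)"
    by (rule nn_integral_joint[symmetric]) measurable
  also have "\<dots> = (\<integral>\<^sup>+ \<omega>. indicator {\<omega> \<in> space M. W \<omega> = f (Y \<omega>)} \<omega> \<partial>M)"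
    by (rule nn_integral_cong) (simp split: split_indicator)
  also have "\<dots> = emeasure M {\<omega> \<in> space M. W \<omega> = f (Y \<omega>)}"
    by simp
  finally show ?thesis
    by (subst integral_eq_nn_integral) (simp_all add: nonneg measure_def)
qed

end

lemma grand_decode_eq_Some_iff:
  "grand_decode C q e T y = Some w \<longleftrightarrow>
    (\<exists>t\<in>{1..T}. candidate q y (e t) = w \<and> w \<in> C \<and> (\<forall>i\<in>{1..<t}. candidate q y (e i) \<notin> C))"
proof (cases "\<exists>t\<in>{1..T}. candidate q y (e t) \<in> C")
  case True
  define P where "P t \<longleftrightarrow> t \<in> {1..T} \<and> candidate q y (e t) \<in> C" for t
  have ex: "\<exists>t. P t" using True by (auto simp: P_def)
  have least: "P t \<and> (\<forall>i\<in>{1..<t}. candidate q y (e i) \<notin> C) \<longleftrightarrow> t = (LEAST t. P t)" for t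
  proof
    assume t: "P t \<and> (\<forall>i\<in>{1..<t}. candidate q y (e i) \<notin> C)"
    show "t = (LEAST t. P t)"
    proof (rule Least_equality[symmetric])
      fix i assume "P i"
      then show "t \<le> i" using t unfolding P_def by (meson atLeastAtMost_iff atLeastLessThan_iff not_le)
    qed (use t in blast)
  next
    assume t: "t = (LEAST t. P t)"
    then have "P t" using ex by (metis LeastI_ex)
    moreover have "\<not> P i" if "i < t" for i
      using that t not_less_Least by blast
    ultimately show "P t \<and> (\<forall>i\<in>{1..<t}. candidate q y (e i) \<notin> C)"
      by (auto simp: P_def)
  qed
  have "grand_decode C q e T y = Some (candidate q y (e (LEAST t. P t)))"
    using True by (simp add: grand_decode_def P_def)
  then have "grand_decode C q e T y = Some w \<longleftrightarrow>
      (\<exists>t. (P t \<and> (\<forall>i\<in>{1..<t}. candidate q y (e i) \<notin> C)) \<and> candidate q y (e t) = w)"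
    unfolding least by simp
  then show ?thesis
    by (auto simp: P_def)
qed (auto simp: grand_decode_def)

lemma bit_vec_add_self: "(v :: bit ^ 'n) + v = 0"
proof -
  have "x + x = 0" for x :: bit
    by (cases "x = 0") simp_all
  then show ?thesis
    by (simp only: vec_eq_iff vector_add_component zero_index simp_thms)
qed

lemma candidate_add_candidate: "candidate q y a + candidate q y b = rank_perm q y (a + b)"
proof -
  have "candidate q y a + candidate q y b =
      (hard_decision q y + hard_decision q y) + (rank_perm q y a + rank_perm q y b)"
    by (simp only: candidate_def ac_simps)
  then show ?thesis
    by (simp only: bit_vec_add_self rank_perm_add add_0)
qed

locale atomless_transmission = code_transmission M q C W Y + atomless_channel q
  for M :: "'a measure" and q
    and C :: "(bit ^ 'n::{finite,linorder}) set"
    and W :: "'a \<Rightarrow> bit ^ 'n::_"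
    and Y :: "'a \<Rightarrow> real ^ 'n::_"
begin

lemma prob_rank_perm_in_code:
  "prob {\<omega> \<in> space M. rank_perm q (Y \<omega>) u \<in> D} =
    real (weight_count D (hamming_weight u)) / real (CARD('n) choose hamming_weight u)"
proof -
  interpret noise: prob_space "noise_law q :: (real ^ 'n::_) measure"
    by (rule prob_space_noise_law)
  have "prob {\<omega> \<in> space M. rank_perm q (Y \<omega>) u \<in> D} =
      measure (noise_law q) {y. rank_perm q y u \<in> D}"
    by (rule prob_eq_noise[where Q = "\<lambda>_ y. rank_perm q y u \<in> D"]) simp_all
  then show ?thesis
    using noise_rank_perm_in_code[of "\<lambda>_. True" u D] noise.prob_space by simp
qed

lemma prob_candidate_and_rank_perm_in_code:
  "prob {\<omega> \<in> space M. W \<omega> = candidate q (Y \<omega>) e \<and> rank_perm q (Y \<omega>) u \<in> D} =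
    prob {\<omega> \<in> space M. W \<omega> = candidate q (Y \<omega>) e} *
      (real (weight_count D (hamming_weight u)) / real (CARD('n) choose hamming_weight u))"
proof -
  let ?B = "\<lambda>y. hard_decision q y = rank_perm q y e"
  have B: "w = candidate q (flip_signs w y) e \<longleftrightarrow> ?B y" if "\<forall>i. llr q (y $ i) \<noteq> 0" for w y
  proof -
    have "candidate q (flip_signs w y) e = w + (hard_decision q y + rank_perm q y e)"
      using that by (simp add: candidate_def hard_decision_flip add.assoc)
    moreover have "hard_decision q y + rank_perm q y e = 0 \<longleftrightarrow> ?B y"
      by (metis add_right_cancel bit_vec_add_self)
    ultimately show ?thesis by simp
  qed
  have "prob {\<omega> \<in> space M. W \<omega> = candidate q (Y \<omega>) e \<and> rank_perm q (Y \<omega>) u \<in> D} =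
      measure (noise_law q) {y. ?B y \<and> rank_perm q y u \<in> D}"
  proof (rule prob_eq_noise[where Q = "\<lambda>w y. w = candidate q y e \<and> rank_perm q y u \<in> D"])
    show "AE y in noise_law q. (w = candidate q (flip_signs w y) e \<and> rank_perm q (flip_signs w y) u \<in> D) \<longleftrightarrow>
        (?B y \<and> rank_perm q y u \<in> D)" for w
      using AE_llr_nonzero by eventually_elim (simp add: B)
  qed measurable
  also have "\<dots> = measure (noise_law q) {y. ?B y} *
      (real (weight_count D (hamming_weight u)) / real (CARD('n) choose hamming_weight u))"
  proof (rule noise_rank_perm_in_code)
    fix \<tau> :: "'n \<Rightarrow> 'n" and y :: "real ^ 'n::_"
    assume \<tau>: "bij \<tau>" and y: "inj (\<lambda>i. \<bar>llr q (y $ i)\<bar>)"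
    have "hard_decision q (\<chi> i. y $ \<tau> i) = (\<chi> i. hard_decision q y $ \<tau> i)"
      by (simp add: hard_decision_def)
    then show "?B (\<chi> i. y $ \<tau> i) \<longleftrightarrow> ?B y"
      using \<tau> by (simp add: rank_perm_permute[OF \<tau> y] vec_eq_iff fun_eq_iff) (metis bij_pointE)
  qed measurable
  also have "measure (noise_law q) {y. ?B y} = prob {\<omega> \<in> space M. W \<omega> = candidate q (Y \<omega>) e}"
  proof (rule prob_eq_noise[where Q = "\<lambda>w y. w = candidate q y e", symmetric])
    show "AE y in noise_law q. w = candidate q (flip_signs w y) e \<longleftrightarrow> ?B y" for w
      using AE_llr_nonzero by eventually_elim (simp add: B)
  qed measurable
  finally show ?thesis .
qed

end

theorem corollary3:
  fixes C :: "(bit ^ ('n::{finite,linorder})) set"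
    and q :: "bit \<Rightarrow> real \<Rightarrow> real"
    and e :: "nat \<Rightarrow> bit ^ 'n::_"
    and T :: nat
    and M :: "'a measure"
    and W :: "'a \<Rightarrow> bit ^ 'n::_"
    and Y :: "'a \<Rightarrow> real ^ 'n::_"
    and p :: "nat \<Rightarrow> real"
    and P_err :: real
  assumes code: "linear_code C"
    and patterns: "inj_on e {1..T}"
    and densities: "\<And>b. prob_density (q b)"
    and symmetric: "output_symmetric q"
    and prob: "prob_space M"
    and joint: "distributed M (count_space UNIV \<Otimes>\<^sub>M lborel) (\<lambda>\<omega>. (W \<omega>, Y \<omega>))
                  (\<lambda>(w, y). ennreal (joint_density C q w y))"
    and bits_uniform: "\<And>i b. measure M {\<omega> \<in> space M. W \<omega> $ i = b} = 1 / 2"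
    and atomless: "\<And>i c. measure M {\<omega> \<in> space M. \<bar>llr q (Y \<omega> $ i)\<bar> = c} = 0"
  defines "p \<equiv> \<lambda>t. integral\<^sup>L M (\<lambda>\<omega>. posterior C q (candidate q (Y \<omega>) (e t)) (Y \<omega>))"
    and "P_err \<equiv> measure M {\<omega> \<in> space M. grand_decode C q e T (Y \<omega>) \<noteq> Some (W \<omega>)}"
  shows "(\<forall>i t. 1 \<le> i \<and> i < t \<and> t \<le> T \<longrightarrow>
            measure M {\<omega> \<in> space M. rank_perm q (Y \<omega>) (e i + e t) \<in> C} =
              real (weight_count C (hamming_weight (e i + e t))) /
              real (CARD('n) choose hamming_weight (e i + e t))) \<and>
         P_err \<le> 1 - (\<Sum>t=1..T. p t) +
           (\<Sum>t=1..T. p t * (\<Sum>i=1..t - 1.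
              real (weight_count C (hamming_weight (e i + e t))) /
              real (CARD('n) choose hamming_weight (e i + e t))))"
proof -
  have zero: "0 \<in> C"
    using code by (rule vec.subspace_0)
  have add: "a + b \<in> C" if "a \<in> C" "b \<in> C" for a b
    using code that by (rule vec.subspace_add)
  interpret symmetric_channel q
    using densities symmetric by unfold_locales
  interpret prob_space M by (rule prob)
  interpret code_transmission M q C W Y
    using zero joint by unfold_locales auto
  interpret atomless_transmission M q C W Y
  proof unfold_locales
    interpret bit_law: prob_space "density lborel (\<lambda>x. ennreal (q 0 x))"
      by (rule prob_space_bit_law)
    fix c
    show "emeasure (density lborel (\<lambda>x. ennreal (q 0 x))) {x. \<bar>llr q x\<bar> = c} = 0"
      using prob_reliability_eq[of undefined c] atomless[of undefined c]
      by (simp add: bit_law.emeasure_eq_measure)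
  qed
  let ?\<rho> = "\<lambda>i t. real (weight_count C (hamming_weight (e i + e t))) /
      real (CARD('n) choose hamming_weight (e i + e t))"
  let ?S = "\<lambda>t. {\<omega> \<in> space M. W \<omega> = candidate q (Y \<omega>) (e t)}"
  let ?F = "\<lambda>i t. {\<omega> \<in> space M. W \<omega> = candidate q (Y \<omega>) (e t) \<and> rank_perm q (Y \<omega>) (e i + e t) \<in> C}"
  let ?G = "\<lambda>t. {\<omega> \<in> space M. W \<omega> = candidate q (Y \<omega>) (e t) \<and>
      (\<forall>i\<in>{1..<t}. rank_perm q (Y \<omega>) (e i + e t) \<notin> C)}"
  let ?D = "{\<omega> \<in> space M. grand_decode C q e T (Y \<omega>) = Some (W \<omega>)}"
  have p: "p t = prob (?S t)" for t
    unfolding p_def by (rule expectation_posterior) measurable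
  have F: "prob (?F i t) = p t * ?\<rho> i t" for i t
    unfolding p by (rule prob_candidate_and_rank_perm_in_code)
  have meas [measurable]: "?S t \<in> events" "?F i t \<in> events" "?G t \<in> events" "?D \<in> events" for i t
    unfolding grand_decode_eq_Some_iff by measurable
  have G: "p t - p t * (\<Sum>i=1..t - 1. ?\<rho> i t) \<le> prob (?G t)" for t
  proof -
    have ivl: "{1..<t} = {1..t - 1}" by auto
    have "p t \<le> prob (?G t \<union> (\<Union>i\<in>{1..<t}. ?F i t))"
      unfolding p by (rule finite_measure_mono) auto
    also have "\<dots> \<le> prob (?G t) + prob (\<Union>i\<in>{1..<t}. ?F i t)"
      by (rule measure_Un_le) measurable
    finally have "p t \<le> prob (?G t) + prob (\<Union>i\<in>{1..<t}. ?F i t)" .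
    moreover have "prob (\<Union>i\<in>{1..<t}. ?F i t) \<le> (\<Sum>i\<in>{1..<t}. prob (?F i t))"
      by (rule finite_measure_subadditive_finite) auto
    moreover have "(\<Sum>i\<in>{1..<t}. prob (?F i t)) = p t * (\<Sum>i=1..t - 1. ?\<rho> i t)"
      by (simp only: F ivl sum_distrib_left)
    ultimately show ?thesis by linarith
  qed
  have disj: "disjoint_family_on ?G {1..T}"
  proof -
    have "?G s \<inter> ?G t = {}" if "1 \<le> s" "s < t" for s t
    proof (rule ccontr)
      assume "?G s \<inter> ?G t \<noteq> {}"
      then obtain \<omega> where G: "\<omega> \<in> ?G s" "\<omega> \<in> ?G t"
        by blast
      have "s \<in> {1..<t}"
        using that by simp
      with G(2) have notin: "rank_perm q (Y \<omega>) (e s + e t) \<notin> C"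
        by blast
      have eq: "candidate q (Y \<omega>) (e s) = candidate q (Y \<omega>) (e t)"
        using G by (elim CollectE conjE) (erule trans[OF sym])
      have "rank_perm q (Y \<omega>) (e s + e t) = candidate q (Y \<omega>) (e s) + candidate q (Y \<omega>) (e s)"
        by (simp only: eq candidate_add_candidate[symmetric])
      also have "\<dots> = 0"
        by (rule bit_vec_add_self)
      finally show False using notin zero by simp
    qed
    then have disj': "?G s \<inter> ?G t = {}" if "1 \<le> s" "1 \<le> t" "s \<noteq> t" for s t
      using that by (cases s t rule: linorder_cases) (blast, blast, blast)
    show ?thesis
      unfolding disjoint_family_on_def by (intro ballI impI disj') simp_all
  qed
  have "AE \<omega> in M. \<omega> \<in> (\<Union>t\<in>{1..T}. ?G t) \<longrightarrow> \<omega> \<in> ?D"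
    using AE_W_in_code
  proof eventually_elim
    fix \<omega> assume W: "W \<omega> \<in> C"
    show "\<omega> \<in> (\<Union>t\<in>{1..T}. ?G t) \<longrightarrow> \<omega> \<in> ?D"
    proof
      assume "\<omega> \<in> (\<Union>t\<in>{1..T}. ?G t)"
      then obtain t where t: "t \<in> {1..T}" "\<omega> \<in> space M" "W \<omega> = candidate q (Y \<omega>) (e t)"
        and no: "\<And>i. i \<in> {1..<t} \<Longrightarrow> rank_perm q (Y \<omega>) (e i + e t) \<notin> C"
        by blast
      have "candidate q (Y \<omega>) (e i) \<notin> C" if "i \<in> {1..<t}" for i
        using no[OF that] add[of "candidate q (Y \<omega>) (e i)" "W \<omega>"] W t(3)
        by (auto simp: candidate_add_candidate)
      then show "\<omega> \<in> ?D"
        using t W by (auto simp: grand_decode_eq_Some_iff)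
    qed
  qed
  then have "prob (\<Union>t\<in>{1..T}. ?G t) \<le> prob ?D"
    by (rule finite_measure_mono_AE) measurable
  moreover have "prob (\<Union>t\<in>{1..T}. ?G t) = (\<Sum>t=1..T. prob (?G t))"
    by (rule finite_measure_finite_Union) (use disj in auto)
  moreover have "P_err = 1 - prob ?D"
    unfolding P_err_def by (rule prob_neg) measurable
  moreover have "(\<Sum>t=1..T. p t - p t * (\<Sum>i=1..t - 1. ?\<rho> i t)) \<le> (\<Sum>t=1..T. prob (?G t))"
    by (intro sum_mono G)
  ultimately have "P_err \<le> 1 - (\<Sum>t=1..T. p t) + (\<Sum>t=1..T. p t * (\<Sum>i=1..t - 1. ?\<rho> i t))"
    by (simp add: sum_subtractf)
  then show ?thesis
    by (simp add: prob_rank_perm_in_code)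
qed

end
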